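(* Let $\sigma=t_1t_2\cdots t_n$ be a sequence with each $t_i\in\{\mathtt{A^*},\mathtt{A^+},\mathtt{A^-},\mathtt{N},\mathtt{S^*},\mathtt{S^+},\mathtt{S^-}\}$, with underlying epr-sequence $\ell_1\ell_2\cdots\ell_n$. Suppose $\ell_{k-1}\ell_k\ell_{k+1}=\mathtt{ANA}$, where $2\le k\le n-2$. Let $\alpha=\{1,\dots,n-1\}\setminus\{k-1,k\}$. Then there exists an $n\times n$ real symmetric matrix $B$ with $\operatorname{sepr}(B)=\sigma$ if and only if one of the following holds: (1) $\sigma=\overline{\mathtt{A^+}}\,\mathtt{A^+NA^-A^-}\,\overline{\mathtt{A^-}}$; (2) $k$ is odd, $t_{k-1}t_kt_{k+1}t_{k+2}=\mathtt{A^+NA^-A^+}$, and $t_{i+1}=\operatorname{neg}(t_i)$ for all $i\in\alpha$; (3) $k$ is even, $t_{k-1}t_kt_{k+1}t_{k+2}=\mathtt{A^-NA^+A^-}$, and $t_{i+1}=\operatorname{neg}(t_i)$ for all $i\in\alpha$.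
   Context: A principal minor of order $k$ of an $n\times n$ matrix is the determinant of a $k\times k$ principal submatrix (same row and column index set). The signed enhanced principal rank characteristic sequence (sepr-sequence) of an $n\times n$ complex Hermitian matrix $B$ is $\operatorname{sepr}(B)=t_1t_2\cdots t_n$, where: $t_k=\mathtt{A^*}$ if all order-$k$ principal minors are nonzero and there are both a positive and a negative one; $t_k=\mathtt{A^+}$ (resp. $\mathtt{A^-}$) if all order-$k$ principal minors are positive (resp. negative); $t_k=\mathtt{N}$ if all are zero; $t_k=\mathtt{S^*}$ if there are a positive, a negative and a zero order-$k$ principal minor; $t_k=\mathtt{S^+}$ (resp. $\mathtt{S^-}$) if there are both a zero and a nonzero order-$k$ principal minor, and every nonzero one is positive (resp. negative). The underlying epr-sequence $\ell_1\cdots\ell_n$ of a sequence in these symbols is obtained by deleting the superscripts, so each $\ell_i\in\{\mathtt{A},\mathtt{N},\mathtt{S}\}$. The operation $\operatorname{neg}$ interchanges the superscripts $+$ and $-$ and leaves $\mathtt{A^*},\mathtt{S^*},\mathtt{N}$ unchanged. An overlined term, such as $\overline{\mathtt{A^+}}$, means that the term may be repeated any number of times, including zero times. *)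

theory Defs
  imports "Jordan_Normal_Form.Determinant" "Jordan_Normal_Form.DL_Submatrix"
    "Jordan_Normal_Form.Conjugate"
begin

datatype sepr_symbol = Astar | Aplus | Aminus | NN | Sstar | Splus | Sminus

datatype epr_symbol = eprA | eprN | eprS

fun underlying :: "sepr_symbol \<Rightarrow> epr_symbol" where
  "underlying Astar = eprA"
| "underlying Aplus = eprA"
| "underlying Aminus = eprA"
| "underlying NN = eprN"
| "underlying Sstar = eprS"
| "underlying Splus = eprS"
| "underlying Sminus = eprS"

fun neg :: "sepr_symbol \<Rightarrow> sepr_symbol" where
  "neg Aplus = Aminus"
| "neg Aminus = Aplus"
| "neg Splus = Sminus"
| "neg Sminus = Splus"
| "neg Astar = Astar"
| "neg Sstar = Sstar"
| "neg NN = NN"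

text \<open>Terms of a sequence are numbered from 1, whereas list positions start at 0.\<close>

definition entry :: "'a list \<Rightarrow> nat \<Rightarrow> 'a" where
  "entry xs i = xs ! (i - 1)"

definition principal_minors :: "'a::comm_ring_1 mat \<Rightarrow> nat \<Rightarrow> 'a set" where
  "principal_minors B k =
     {det (submatrix B I I) | I. I \<subseteq> {0..<dim_row B} \<and> card I = k}"

text \<open>
  The class covers both the reals and the complex numbers. The order on the latter is that of
  \<^theory>\<open>HOL-Library.Complex_Order\<close>: \<open>0 < z\<close> means that \<open>z\<close> is real and positive. The principal
  minors of a Hermitian matrix are real, so for Hermitian matrices and \<open>1 \<le> k \<le> n\<close> one of the
  seven listed cases applies and the final \<open>undefined\<close> is never reached.
\<close>

definition sepr_term :: "'a::conjugatable_ordered_field mat \<Rightarrow> nat \<Rightarrow> sepr_symbol" where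
  "sepr_term B k = (let M = principal_minors B k in
     if (\<forall>m\<in>M. m \<noteq> 0) \<and> (\<exists>m\<in>M. m > 0) \<and> (\<exists>m\<in>M. m < 0) then Astar
     else if (\<forall>m\<in>M. m > 0) then Aplus
     else if (\<forall>m\<in>M. m < 0) then Aminus
     else if (\<forall>m\<in>M. m = 0) then NN
     else if (\<exists>m\<in>M. m > 0) \<and> (\<exists>m\<in>M. m < 0) \<and> (\<exists>m\<in>M. m = 0) then Sstar
     else if (\<exists>m\<in>M. m = 0) \<and> (\<exists>m\<in>M. m \<noteq> 0) \<and> (\<forall>m\<in>M. m \<noteq> 0 \<longrightarrow> m > 0) then Splus
     else if (\<exists>m\<in>M. m = 0) \<and> (\<exists>m\<in>M. m \<noteq> 0) \<and> (\<forall>m\<in>M. m \<noteq> 0 \<longrightarrow> m < 0) then Sminus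
     else undefined)"

definition sepr :: "'a::conjugatable_ordered_field mat \<Rightarrow> sepr_symbol list" where
  "sepr B = map (sepr_term B) [1..<dim_row B + 1]"

text \<open>A real symmetric matrix has the same sequence when it is viewed as a complex Hermitian one.\<close>

lemma sepr_map_mat_of_real:
  assumes "B \<in> carrier_mat n n"
  shows "sepr (map_mat complex_of_real B) = sepr B"
proof -
  have sub: "submatrix (map_mat complex_of_real B) I I = map_mat complex_of_real (submatrix B I I)"
    for I
    using assms pick_le[of _ n I] by (intro eq_matI) (auto simp: submatrix_def)
  have "principal_minors (map_mat complex_of_real B) k = complex_of_real ` principal_minors B k"
    for k
    unfolding principal_minors_def sub of_real_hom.hom_det by auto
  moreover have "complex_of_real x > 0 \<longleftrightarrow> x > 0" "complex_of_real x < 0 \<longleftrightarrow> x < 0" for x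
    by (simp_all add: less_complex_def)
  ultimately have "sepr_term (map_mat complex_of_real B) k = sepr_term B k" for k
    by (simp only: sepr_term_def Let_def ball_simps bex_simps of_real_eq_0_iff)
  then show ?thesis
    by (simp add: sepr_def)
qed

end

theory Submission
  imports Defs
begin

text \<open>Only two sign patterns occur, those of \<open>\<plusminus>(k I - J)\<close> with \<open>J\<close> the all-ones matrix, whose principal
  minors of order \<open>m\<close> are \<open>(\<plusminus>1)\<^sup>m k\<^sup>m\<^sup>-\<^sup>1 (k - m)\<close>.

  Conversely, let \<open>B\<close> have \<open>ANA\<close> at \<open>k - 1, k, k + 1\<close> and let \<open>D\<close> be a principal submatrix of order
  \<open>k + 2\<close>. It is nonsingular, and by complementarity of minors its inverse \<open>F\<close> has nonzero diagonal,
  vanishing principal minors of order 2 and nonvanishing ones of order 3. After a diagonal congruence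
  \<open>F\<close> therefore has diagonal \<open>\<plusminus>1\<close> and off-diagonal entries of absolute value 1 whose signs can be
  switched to be all opposite to the diagonal, so \<open>F\<close> is congruent to \<open>\<plusminus>(2 I - J)\<close> and \<open>D\<close> to a multiple of
  \<open>k I - J\<close>. The relations expressing this shape involve only three indices at a time, hence \<open>B\<close> itself
  is diagonally congruent to \<open>\<plusminus>(k I - J)\<close>. Only the vanishing of minors is used, so
  all of this can be phrased through kernel vectors supported on index sets.\<close>

section \<open>Singular blocks, inverses and complementary minors\<close>

text \<open>The set-indexed form of a vanishing principal minor: passing to subsets or complements
  then involves no renumbering of rows.\<close>

definition singular_on :: "('i \<Rightarrow> 'i \<Rightarrow> 'a::field) \<Rightarrow> 'i set \<Rightarrow> bool" where
  "singular_on b I \<longleftrightarrow> (\<exists>x. (\<exists>i\<in>I. x i \<noteq> 0) \<and> (\<forall>i\<in>I. (\<Sum>j\<in>I. b i j * x j) = 0))"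

text \<open>Kernel vectors are extended by zero, so that blocks on different subsets are tested with
  sums over the same \<open>D\<close>. The rows outside \<open>I\<close> stay unconstrained.\<close>

lemma singular_on_iff_supported:
  assumes "finite D" "I \<subseteq> D"
  shows "singular_on b I \<longleftrightarrow>
    (\<exists>x. (\<forall>i\<in>D - I. x i = 0) \<and> (\<exists>i\<in>I. x i \<noteq> 0) \<and> (\<forall>i\<in>I. (\<Sum>j\<in>D. b i j * x j) = 0))"
proof
  assume "singular_on b I"
  then obtain x where x: "\<exists>i\<in>I. x i \<noteq> 0" "\<forall>i\<in>I. (\<Sum>j\<in>I. b i j * x j) = 0"
    unfolding singular_on_def by blast
  define y where "y = (\<lambda>i. if i \<in> I then x i else 0)"
  have "(\<Sum>j\<in>D. b i j * y j) = (\<Sum>j\<in>I. b i j * x j)" for i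
    using assms by (intro sum.mono_neutral_cong_right) (auto simp: y_def)
  with x show "\<exists>x. (\<forall>i\<in>D - I. x i = 0) \<and> (\<exists>i\<in>I. x i \<noteq> 0) \<and> (\<forall>i\<in>I. (\<Sum>j\<in>D. b i j * x j) = 0)"
    by (intro exI[of _ y]) (auto simp: y_def)
next
  assume "\<exists>x. (\<forall>i\<in>D - I. x i = 0) \<and> (\<exists>i\<in>I. x i \<noteq> 0) \<and> (\<forall>i\<in>I. (\<Sum>j\<in>D. b i j * x j) = 0)"
  then obtain x where x: "\<forall>i\<in>D - I. x i = 0" "\<exists>i\<in>I. x i \<noteq> 0"
    "\<forall>i\<in>I. (\<Sum>j\<in>D. b i j * x j) = 0" by blast
  have "(\<Sum>j\<in>D. b i j * x j) = (\<Sum>j\<in>I. b i j * x j)" for i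
    using assms x(1) by (intro sum.mono_neutral_right) auto
  with x show "singular_on b I"
    unfolding singular_on_def by metis
qed

lemma det_eq_0_iff_singular_on:
  fixes b :: "'i \<Rightarrow> 'i \<Rightarrow> 'a::field"
  assumes h: "bij_betw h {0..<m} I"
  shows "det (mat m m (\<lambda>(i, j). b (h i) (h j))) = 0 \<longleftrightarrow> singular_on b I"
proof -
  let ?M = "mat m m (\<lambda>(i, j). b (h i) (h j))"
  let ?g = "inv_into {0..<m} h"
  have inj: "inj_on h {0..<m}" and I: "I = h ` {0..<m}"
    using h by (auto simp: bij_betw_def)
  have g: "?g (h p) = p" if "p < m" for p
    using that inj by simp
  have reindex: "(\<Sum>j\<in>I. F j) = (\<Sum>r\<in>{0..<m}. F (h r))" for F :: "'i \<Rightarrow> 'a"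
    by (rule sum.reindex_bij_betw[OF h, symmetric])
  have "det ?M = 0 \<longleftrightarrow> (\<exists>v. v \<in> carrier_vec m \<and> v \<noteq> 0\<^sub>v m \<and> ?M *\<^sub>v v = 0\<^sub>v m)"
    by (rule det_0_iff_vec_prod_zero_field) simp
  also have "\<dots> \<longleftrightarrow> singular_on b I"
  proof
    assume "\<exists>v. v \<in> carrier_vec m \<and> v \<noteq> 0\<^sub>v m \<and> ?M *\<^sub>v v = 0\<^sub>v m"
    then obtain v where v: "v \<in> carrier_vec m" "v \<noteq> 0\<^sub>v m" "?M *\<^sub>v v = 0\<^sub>v m" by blast
    have "(\<Sum>r\<in>{0..<m}. b (h p) (h r) * v $ r) = 0" if "p < m" for p
    proof -
      have "(?M *\<^sub>v v) $ p = 0" using v(3) that by simp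
      then show ?thesis using that v(1) by (simp add: scalar_prod_def)
    qed
    moreover obtain p where "p < m" "v $ p \<noteq> 0"
      using v(1,2) by (metis carrier_vecD eq_vecI index_zero_vec)
    ultimately show "singular_on b I"
      unfolding singular_on_def reindex by (intro exI[of _ "\<lambda>i. v $ ?g i"]) (auto simp: I g)
  next
    assume "singular_on b I"
    then obtain x where x: "\<exists>i\<in>I. x i \<noteq> 0" "\<forall>i\<in>I. (\<Sum>j\<in>I. b i j * x j) = 0"
      unfolding singular_on_def by blast
    have "vec m (\<lambda>p. x (h p)) \<noteq> 0\<^sub>v m"
    proof
      assume *: "vec m (\<lambda>p. x (h p)) = 0\<^sub>v m"
      have "x (h p) = 0" if "p < m" for p
        using that arg_cong[OF *, of "\<lambda>v. v $ p"] by simp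
      with x(1) show False by (auto simp: I)
    qed
    moreover have "?M *\<^sub>v vec m (\<lambda>p. x (h p)) = 0\<^sub>v m"
      using x(2)[unfolded reindex] by (intro eq_vecI) (auto simp: scalar_prod_def I)
    ultimately show "\<exists>v. v \<in> carrier_vec m \<and> v \<noteq> 0\<^sub>v m \<and> ?M *\<^sub>v v = 0\<^sub>v m"
      by (intro exI[of _ "vec m (\<lambda>p. x (h p))"]) auto
  qed
  finally show ?thesis .
qed

lemma nonsingular_on_inverse:
  fixes b :: "'i \<Rightarrow> 'i \<Rightarrow> 'a::field"
  assumes "finite I" "\<not> singular_on b I"
  obtains f where "\<And>i l. i \<in> I \<Longrightarrow> l \<in> I \<Longrightarrow> (\<Sum>j\<in>I. b i j * f j l) = (if i = l then 1 else 0)"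
    and "\<And>i l. i \<in> I \<Longrightarrow> l \<in> I \<Longrightarrow> (\<Sum>j\<in>I. f i j * b j l) = (if i = l then 1 else 0)"
proof -
  obtain h where h: "bij_betw h {0..<card I} I"
    using ex_bij_betw_nat_finite[OF assms(1)] by blast
  define m where "m = card I"
  note h = h[folded m_def]
  let ?M = "mat m m (\<lambda>(i, j). b (h i) (h j))"
  let ?g = "inv_into {0..<m} h"
  have inj: "inj_on h {0..<m}" and I: "I = h ` {0..<m}"
    using h by (auto simp: bij_betw_def)
  have g: "?g (h p) = p" if "p < m" for p
    using that inj by simp
  have reindex: "(\<Sum>j\<in>I. F j) = (\<Sum>r\<in>{0..<m}. F (h r))" for F :: "'i \<Rightarrow> 'a"
    by (rule sum.reindex_bij_betw[OF h, symmetric])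
  have "det ?M \<noteq> 0"
    using det_eq_0_iff_singular_on[OF h, of b] assms(2) by simp
  then have "?M \<in> Units (ring_mat TYPE('a) m ())"
    by (intro det_non_zero_imp_unit) auto
  then obtain N where N: "N \<in> carrier_mat m m" "?M * N = 1\<^sub>m m" "N * ?M = 1\<^sub>m m"
    by (auto simp: Units_def ring_mat_def)
  have MN: "(\<Sum>r\<in>{0..<m}. b (h p) (h r) * N $$ (r, q)) = (if p = q then 1 else 0)"
    if "p < m" "q < m" for p q
    using arg_cong[OF N(2), of "\<lambda>A. A $$ (p, q)"] that N(1) by (simp add: scalar_prod_def)
  have NM: "(\<Sum>r\<in>{0..<m}. N $$ (p, r) * b (h r) (h q)) = (if p = q then 1 else 0)"
    if "p < m" "q < m" for p q
    using arg_cong[OF N(3), of "\<lambda>A. A $$ (p, q)"] that N(1) by (simp add: scalar_prod_def)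
  show thesis
  proof (rule that[of "\<lambda>i l. N $$ (?g i, ?g l)"])
    fix i l assume "i \<in> I" "l \<in> I"
    then obtain p q where p: "i = h p" "p < m" and q: "l = h q" "q < m" by (auto simp: I)
    have "h p = h q \<longleftrightarrow> p = q" using p q inj by (auto simp: inj_on_def)
    then show "(\<Sum>j\<in>I. b i j * N $$ (?g j, ?g l)) = (if i = l then 1 else 0)"
      and "(\<Sum>j\<in>I. N $$ (?g i, ?g j) * b j l) = (if i = l then 1 else 0)"
      using MN[OF p(2) q(2)] NM[OF p(2) q(2)] p q by (simp_all add: reindex g)
  qed
qed

text \<open>The vanishing case of Jacobi's identity for complementary minors. If \<open>x\<close> is
  supported on \<open>I\<close> and \<open>y = b x\<close> vanishes on \<open>I\<close>, then
  \<open>y\<close> is supported on the complement, where \<open>f y = x\<close> vanishes;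
  \<open>y\<close> is nonzero because \<open>x\<close> is recovered from it. For a two-sided
  inverse, exchanging \<open>b\<close> and \<open>f\<close> gives the converse.\<close>

lemma singular_on_inverse_complement:
  fixes b f :: "'i \<Rightarrow> 'i \<Rightarrow> 'a::field"
  assumes D: "finite D" "I \<subseteq> D"
    and fb: "\<And>i l. i \<in> D \<Longrightarrow> l \<in> D \<Longrightarrow> (\<Sum>j\<in>D. f i j * b j l) = (if i = l then 1 else 0)"
    and "singular_on b I"
  shows "singular_on f (D - I)"
proof -
  obtain x where x: "\<forall>i\<in>D - I. x i = 0" "\<exists>i\<in>I. x i \<noteq> 0" "\<forall>i\<in>I. (\<Sum>j\<in>D. b i j * x j) = 0"
    using assms singular_on_iff_supported[OF D, of b] by blast
  define y where "y i = (\<Sum>j\<in>D. b i j * x j)" for i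
  have fy: "(\<Sum>j\<in>D. f i j * y j) = x i" if "i \<in> D" for i
  proof -
    have "(\<Sum>j\<in>D. f i j * y j) = (\<Sum>j\<in>D. \<Sum>l\<in>D. f i j * b j l * x l)"
      by (simp add: y_def sum_distrib_left mult.assoc)
    also have "\<dots> = (\<Sum>l\<in>D. (\<Sum>j\<in>D. f i j * b j l) * x l)"
      by (subst sum.swap) (simp add: sum_distrib_right)
    also have "\<dots> = (\<Sum>l\<in>D. if i = l then x l else 0)"
      using that by (intro sum.cong) (auto simp: fb)
    also have "\<dots> = x i" using that D(1) by simp
    finally show ?thesis .
  qed
  have yI: "y i = 0" if "i \<in> I" for i
    using x(3) that by (simp add: y_def)
  have "\<exists>i\<in>D - I. y i \<noteq> 0"
  proof (rule ccontr)
    assume "\<not> (\<exists>i\<in>D - I. y i \<noteq> 0)"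
    with yI have "y i = 0" if "i \<in> D" for i using that by blast
    then have "x i = 0" if "i \<in> D" for i using fy[OF that] by simp
    with x(2) D(2) show False by blast
  qed
  moreover have "D - (D - I) = I" using D(2) by blast
  ultimately show ?thesis
    using x(1) fy yI D(1) by (subst singular_on_iff_supported[of D]) (auto intro!: exI[of _ y])
qed

text \<open>Both entries are read off from the product of the transpose of \<open>f\<close>,
  \<open>b\<close> and \<open>f\<close>, which inherits symmetry from \<open>b\<close>.\<close>

lemma inverse_symmetric:
  fixes b f :: "'i \<Rightarrow> 'i \<Rightarrow> 'a::field"
  assumes D: "finite D"
    and sym: "\<And>i j. i \<in> D \<Longrightarrow> j \<in> D \<Longrightarrow> b i j = b j i"
    and bf: "\<And>i l. i \<in> D \<Longrightarrow> l \<in> D \<Longrightarrow> (\<Sum>j\<in>D. b i j * f j l) = (if i = l then 1 else 0)"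
    and l: "l \<in> D" and m: "m \<in> D"
  shows "f l m = f m l"
proof -
  have "f l m = (\<Sum>i\<in>D. f i m * (\<Sum>j\<in>D. b i j * f j l))"
    using l D bf by (simp add: if_distrib[of "\<lambda>x. f _ m * x"] cong: if_cong)
  also have "\<dots> = (\<Sum>i\<in>D. \<Sum>j\<in>D. f j l * (b j i * f i m))"
    unfolding sum_distrib_left by (intro sum.cong) (auto simp: sym)
  also have "\<dots> = (\<Sum>j\<in>D. f j l * (\<Sum>i\<in>D. b j i * f i m))"
    by (subst sum.swap) (simp add: sum_distrib_left)
  also have "\<dots> = f m l"
    using m D bf by (simp add: if_distrib[of "\<lambda>x. f _ l * x"] cong: if_cong)
  finally show ?thesis .
qed

section \<open>Recognizing a diagonally scaled equicorrelation matrix\<close>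

text \<open>A reference index \<open>z\<close> fixes the sign \<open>e\<close> and all scaling
  factors through its row. Then \<open>sq\<close> with \<open>z\<close> determines the other
  diagonal entries, and \<open>tri\<close> with \<open>z\<close> determines the other off-diagonal
  entries.\<close>

lemma scaled_equicorrelation:
  fixes g :: "'i \<Rightarrow> 'i \<Rightarrow> real"
  assumes c: "c > 0"
    and sym: "\<And>i j. i \<in> D \<Longrightarrow> j \<in> D \<Longrightarrow> g i j = g j i"
    and diag: "\<And>i. i \<in> D \<Longrightarrow> g i i \<noteq> 0"
    and sq: "\<And>i j. i \<in> D \<Longrightarrow> j \<in> D \<Longrightarrow> i \<noteq> j \<Longrightarrow> c\<^sup>2 * (g i j)\<^sup>2 = g i i * g j j"
    and tri: "\<And>i j l. i \<in> D \<Longrightarrow> j \<in> D \<Longrightarrow> l \<in> D \<Longrightarrow> i \<noteq> j \<Longrightarrow> j \<noteq> l \<Longrightarrow> l \<noteq> i \<Longrightarrow>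
      c ^ 3 * (g i j * g j l * g l i) = - (g i i * g j j * g l l)"
  obtains e r where "e = 1 \<or> e = -1" "\<And>i. i \<in> D \<Longrightarrow> r i \<noteq> 0"
    "\<And>i j. i \<in> D \<Longrightarrow> j \<in> D \<Longrightarrow> g i j = e * r i * r j * (if i = j then c else -1)"
proof (cases "D = {}")
  case True
  then show thesis using that[of 1 "\<lambda>_. 1"] by simp
next
  case False
  then obtain z where z: "z \<in> D" by blast
  define e where "e = sgn (g z z)"
  define q where "q = sqrt (\<bar>g z z\<bar> / c)"
  define r where "r i = (if i = z then q else - e * g z i / q)" for i
  have e: "e = 1 \<or> e = -1" "e * e = 1"
    using diag[OF z] by (auto simp: e_def sgn_if)
  have q: "q > 0" "q * q = \<bar>g z z\<bar> / c"
    using diag[OF z] c by (simp_all add: q_def)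
  have gzz: "g z z = e * q * q * c"
    using q c diag[OF z] by (simp add: mult.assoc[of e] e_def sgn_if)
  have gzj: "g z j = - (e * q * r j)" if "j \<in> D" "j \<noteq> z" for j
    using that q e by (auto simp: r_def)
  have rj: "r j \<noteq> 0" if "j \<in> D" for j
  proof (cases "j = z")
    case True
    then show ?thesis using q by (simp add: r_def)
  next
    case False
    have "g z j \<noteq> 0" using sq[OF z that] False diag[OF z] diag[OF that] by auto
    with gzj[OF that False] show ?thesis by auto
  qed
  have gjj: "g j j = e * r j * r j * c" if "j \<in> D" for j
  proof (cases "j = z")
    case True
    then show ?thesis using gzz by (simp add: r_def)
  next
    case False
    have "(e * q * q * c) * g j j = c\<^sup>2 * (e * q * r j)\<^sup>2"
      using sq[OF z that] False gzj[OF that False] gzz by simp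
    also have "\<dots> = (e * q * q * c) * (e * r j * r j * c)"
      by (simp add: power2_eq_square algebra_simps)
    finally show ?thesis using e q c by auto
  qed
  have gjl: "g j l = - (e * r j * r l)" if jl: "j \<in> D" "l \<in> D" "j \<noteq> l" for j l
  proof -
    consider "j = z" | "l = z" | "j \<noteq> z" "l \<noteq> z" by blast
    then show ?thesis
    proof cases
      case 1
      then show ?thesis using gzj[of l] jl by (simp add: r_def)
    next
      case 2
      then show ?thesis using gzj[of j] jl sym[of j z] by (simp add: r_def)
    next
      case 3
      \<comment> \<open>In the triple \<open>z, j, l\<close> every factor except
        \<open>g j l\<close> is already expressed through \<open>r\<close>, so the relation can be
        solved for it.\<close>
      have "c ^ 3 * (- (e * q * r j) * g j l * - (e * q * r l))
          = - ((e * q * q * c) * (e * r j * r j * c) * (e * r l * r l * c))"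
        using tri[OF z jl(1,2)] 3 jl gzj[of j] gzj[of l] gjj[of j] gjj[of l] gzz sym[of l z] z by simp
      then have "(c ^ 3 * (q * q * r j * r l) * (e * e)) * g j l
          = (c ^ 3 * (q * q * r j * r l) * (e * e)) * (- (e * r j * r l))"
        by (simp add: power3_eq_cube algebra_simps)
      moreover have "c ^ 3 * (q * q * r j * r l) * (e * e) \<noteq> 0"
        using c q(1) rj[OF jl(1)] rj[OF jl(2)] e(2) by simp
      ultimately show ?thesis by (metis mult_left_cancel)
    qed
  qed
  show thesis
    by (rule that[OF e(1) rj]) (auto simp: gjj gjl)
qed

section \<open>From the vanishing pattern of minors to the shape of the matrix\<close>

text \<open>A kernel vector \<open>x\<close> on \<open>D\<close> has no zero entry. For \<open>i \<noteq> j\<close>, a kernel vector \<open>y\<close> on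
  \<open>D - {i, j}\<close> can be scaled so that \<open>b y = e\<^sub>i / x\<^sub>i - e\<^sub>j / x\<^sub>j\<close>. Pairing these vectors for the three
  pairs of a triple \<open>i, j, l\<close> by the symmetric form \<open>b\<close>, the three entries outside the pairs are forced
  to vanish, which produces a kernel vector on \<open>D - {i, j, l}\<close>.\<close>

lemma nonsingular_on_if_codim_2_singular:
  fixes b :: "'i \<Rightarrow> 'i \<Rightarrow> real"
  assumes D: "finite D" "card D \<ge> 3"
    and sym: "\<And>i j. i \<in> D \<Longrightarrow> j \<in> D \<Longrightarrow> b i j = b j i"
    and one: "\<And>i. i \<in> D \<Longrightarrow> \<not> singular_on b (D - {i})"
    and two: "\<And>i j. i \<in> D \<Longrightarrow> j \<in> D \<Longrightarrow> i \<noteq> j \<Longrightarrow> singular_on b (D - {i, j})"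
    and three: "\<And>i j l. i \<in> D \<Longrightarrow> j \<in> D \<Longrightarrow> l \<in> D \<Longrightarrow> i \<noteq> j \<Longrightarrow> j \<noteq> l \<Longrightarrow> l \<noteq> i \<Longrightarrow>
      \<not> singular_on b (D - {i, j, l})"
  shows "\<not> singular_on b D"
proof
  assume "singular_on b D"
  define ap where "ap y i = (\<Sum>j\<in>D. b i j * y j)" for y i
  have pair: "(\<Sum>i\<in>D. y i * ap w i) = (\<Sum>i\<in>D. w i * ap y i)" for y w
  proof -
    have "(\<Sum>i\<in>D. y i * ap w i) = (\<Sum>i\<in>D. \<Sum>j\<in>D. y i * (b i j * w j))"
      by (simp add: ap_def sum_distrib_left)
    also have "\<dots> = (\<Sum>j\<in>D. \<Sum>i\<in>D. w j * (b j i * y i))"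
      by (subst sum.swap) (intro sum.cong, auto simp: sym)
    finally show ?thesis by (simp add: ap_def sum_distrib_left)
  qed
  have kernel_zero: "y m = 0" if "\<And>m. m \<in> D \<Longrightarrow> ap y m = 0" "i \<in> D" "y i = 0" "m \<in> D" for y i m
  proof (rule ccontr)
    assume "y m \<noteq> 0"
    with that have "singular_on b (D - {i})"
      by (subst singular_on_iff_supported[OF D(1)]) (auto simp: ap_def intro!: exI[of _ y])
    with one[OF that(2)] show False by blast
  qed
  obtain x where x: "\<exists>i\<in>D. x i \<noteq> 0" "\<And>i. i \<in> D \<Longrightarrow> ap x i = 0"
    using \<open>singular_on b D\<close> unfolding singular_on_def ap_def by blast
  have x_nz: "x i \<noteq> 0" if "i \<in> D" for i
    using kernel_zero[OF x(2) that] x(1) by blast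
  have ex: "\<exists>y. y i = 0 \<and> y j = 0 \<and> (\<exists>m\<in>D. y m \<noteq> 0) \<and> ap y i = 1 / x i \<and> ap y j = - 1 / x j
      \<and> (\<forall>m\<in>D - {i, j}. ap y m = 0)"
    if ij: "i \<in> D" "j \<in> D" "i \<noteq> j" for i j
  proof -
    have "D - (D - {i, j}) = {i, j}" using ij by blast
    then obtain y where y: "y i = 0" "y j = 0" "\<exists>m\<in>D. y m \<noteq> 0" "\<forall>m\<in>D - {i, j}. ap y m = 0"
      using two[OF ij] singular_on_iff_supported[OF D(1), of "D - {i, j}" b]
      unfolding ap_def by auto
    \<comment> \<open>Pairing with the kernel vector \<open>x\<close> leaves only the indices
      \<open>i\<close> and \<open>j\<close>, so the two remaining values of \<open>ap y\<close> are
      in the ratio of \<open>1 / x i\<close> to \<open>- 1 / x j\<close>.\<close>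
    have "0 = (\<Sum>m\<in>D. x m * ap y m)"
      using pair[of x y] x(2) by simp
    also have "\<dots> = (\<Sum>m\<in>{i, j}. x m * ap y m)"
      using y(4) ij D(1) by (intro sum.mono_neutral_right) auto
    finally have s: "x i * ap y i + x j * ap y j = 0" using ij by simp
    define t where "t = x i * ap y i"
    have t: "ap y i = t / x i" "ap y j = - t / x j"
      using s x_nz[OF ij(1)] x_nz[OF ij(2)] by (auto simp: t_def field_simps)
    have "t \<noteq> 0"
    proof
      assume "t = 0"
      then have "ap y m = 0" if "m \<in> D" for m using t y(4) that by (cases "m = i \<or> m = j") auto
      from kernel_zero[OF this ij(1) y(1)] y(3) show False by blast
    qed
    have "ap (\<lambda>m. y m / t) m = ap y m / t" for m
      by (simp add: ap_def sum_divide_distrib)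
    with y t \<open>t \<noteq> 0\<close> show ?thesis by (intro exI[of _ "\<lambda>m. y m / t"]) auto
  qed
  \<comment> \<open>The pairs \<open>{i, j}\<close> and \<open>{j, m}\<close> overlap in
    \<open>j\<close>, where both vectors vanish; hence each side of \<open>pair\<close> reduces to a
    single term.\<close>
  have cross: "y m / x m = - (w i / x i)"
    if d: "i \<in> D" "j \<in> D" "m \<in> D" "i \<noteq> j" "j \<noteq> m" "m \<noteq> i"
      and y: "y i = 0" "y j = 0" "ap y i = 1 / x i" "ap y j = - 1 / x j" "\<forall>q\<in>D - {i, j}. ap y q = 0"
      and w: "w j = 0" "w m = 0" "ap w j = 1 / x j" "ap w m = - 1 / x m" "\<forall>q\<in>D - {j, m}. ap w q = 0"
    for i j m y w
  proof -
    have "(\<Sum>q\<in>D. y q * ap w q) = (\<Sum>q\<in>{j, m}. y q * ap w q)"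
      using w(5) d D(1) by (intro sum.mono_neutral_right) auto
    moreover have "(\<Sum>q\<in>D. w q * ap y q) = (\<Sum>q\<in>{i, j}. w q * ap y q)"
      using y(5) d D(1) by (intro sum.mono_neutral_right) auto
    ultimately show ?thesis using pair[of y w] d y w by simp
  qed
  obtain T where "T \<subseteq> D" "card T = 3" using obtain_subset_with_card_n[OF D(2)] by blast
  then obtain i j l where d: "i \<in> D" "j \<in> D" "l \<in> D" "i \<noteq> j" "j \<noteq> l" "l \<noteq> i"
    by (auto simp: card_3_iff)
  obtain u where u: "u i = 0" "u j = 0" "\<exists>m\<in>D. u m \<noteq> 0" "ap u i = 1 / x i" "ap u j = - 1 / x j"
    "\<forall>m\<in>D - {i, j}. ap u m = 0" using ex[OF d(1,2,4)] by blast
  obtain v where v: "v j = 0" "v l = 0" "ap v j = 1 / x j" "ap v l = - 1 / x l"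
    "\<forall>m\<in>D - {j, l}. ap v m = 0" using ex[OF d(2,3,5)] by blast
  obtain w where w: "w l = 0" "w i = 0" "ap w l = 1 / x l" "ap w i = - 1 / x i"
    "\<forall>m\<in>D - {l, i}. ap w m = 0" using ex[OF d(3,1,6)] by blast
  have "u l / x l = - (v i / x i)"
    by (rule cross[OF d(1,2,3) d(4,5,6) u(1,2,4-6) v])
  moreover have "v i / x i = - (w j / x j)"
    by (rule cross[OF d(2,3,1) d(5,6,4) v w])
  moreover have "w j / x j = - (u l / x l)"
    by (rule cross[OF d(3,1,2) d(6,4,5) w u(1,2,4-6)])
  \<comment> \<open>Going once around the triple changes the sign three times, so
    \<open>u l / x l\<close> equals its own negative.\<close>
  ultimately have "u l = 0" using x_nz[OF d(3)] by simp
  with u have "singular_on b (D - {i, j, l})"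
    by (subst singular_on_iff_supported[OF D(1)]) (auto simp: ap_def intro!: exI[of _ u])
  with three[OF d] show False by blast
qed

text \<open>Cramer's rule: the determinant times either coordinate of a kernel vector is a
  combination of the two kernel equations.\<close>

lemma singular_on_pair_det:
  fixes f :: "'i \<Rightarrow> 'i \<Rightarrow> real"
  assumes "singular_on f {i, j}" "i \<noteq> j" "f i j = f j i"
  shows "(f i j)\<^sup>2 = f i i * f j j"
proof -
  obtain x where x: "x i \<noteq> 0 \<or> x j \<noteq> 0" "f i i * x i + f i j * x j = 0"
    "f i j * x i + f j j * x j = 0"
    using assms unfolding singular_on_def by auto
  have "((f i j)\<^sup>2 - f i i * f j j) * x i
      = f i j * (f i j * x i + f j j * x j) - f j j * (f i i * x i + f i j * x j)"
    by (simp add: power2_eq_square algebra_simps)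
  moreover have "((f i j)\<^sup>2 - f i i * f j j) * x j
      = f i j * (f i i * x i + f i j * x j) - f i i * (f i j * x i + f j j * x j)"
    by (simp add: power2_eq_square algebra_simps)
  ultimately show ?thesis using x by auto
qed

text \<open>For a \<open>3 \<times> 3\<close> symmetric matrix with nonzero diagonal and vanishing principal \<open>2 \<times> 2\<close> minors, the
  products \<open>p = f\<^sub>i\<^sub>j f\<^sub>j\<^sub>l f\<^sub>l\<^sub>i\<close> and \<open>q = f\<^sub>i\<^sub>i f\<^sub>j\<^sub>j f\<^sub>l\<^sub>l\<close> satisfy \<open>p\<^sup>2 = q\<^sup>2\<close>, and \<open>p = q\<close> makes two columns
  proportional.\<close>

lemma nonsingular_on_triple_product:
  fixes f :: "'i \<Rightarrow> 'i \<Rightarrow> real"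
  assumes ns: "\<not> singular_on f {i, j, l}" and d: "i \<noteq> j" "j \<noteq> l" "l \<noteq> i"
    and sym: "f j i = f i j" "f l j = f j l" "f i l = f l i"
    and diag: "f i i \<noteq> 0" "f j j \<noteq> 0" "f l l \<noteq> 0"
    and sq: "(f i j)\<^sup>2 = f i i * f j j" "(f j l)\<^sup>2 = f j j * f l l" "(f l i)\<^sup>2 = f l l * f i i"
  shows "f i j * f j l * f l i = - (f i i * f j j * f l l)"
proof -
  have "(f i j * f j l * f l i)\<^sup>2 = (f i i * f j j * f l l)\<^sup>2"
    by (simp add: power_mult_distrib sq) (simp add: power2_eq_square)
  moreover have "f i j * f j l * f l i \<noteq> f i i * f j j * f l l"
  proof
    assume "f i j * f j l * f l i = f i i * f j j * f l l"
    also have "\<dots> = f j j * (f l i)\<^sup>2" by (simp add: sq)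
    finally have "(f i j * f j l) * f l i = (f j j * f l i) * f l i"
      by (simp add: power2_eq_square)
    moreover have "f l i \<noteq> 0" using sq(3) diag by auto
    ultimately have "f i j * f j l = f j j * f l i" by simp
    \<comment> \<open>The witness expresses that columns \<open>i\<close> and \<open>j\<close> are
      proportional: row \<open>i\<close> vanishes by \<open>sq\<close>, row \<open>j\<close> by
      symmetry, row \<open>l\<close> by the preceding equation.\<close>
    then have "singular_on f {i, j, l}"
      unfolding singular_on_def using d sym sq(1) diag(2)
      by (intro exI[of _ "\<lambda>m. if m = i then f j j else if m = j then - f i j else 0"])
        (auto simp: power2_eq_square algebra_simps)
    with ns show False by blast
  qed
  ultimately show ?thesis by (auto simp: power2_eq_iff)
qed

text \<open>Complements of index sets of sizes \<open>k + 1\<close>, \<open>k\<close>,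
  \<open>k - 1\<close> in \<open>D\<close> have sizes 1, 2, 3, so the hypotheses become conditions
  on small blocks of the inverse \<open>f\<close>. These give \<open>f\<close> the shape of a scaled
  \<open>2 I - J\<close>, which is then inverted explicitly.\<close>

lemma scaled_equicorrelation_of_minors_local:
  fixes b :: "'i \<Rightarrow> 'i \<Rightarrow> real"
  assumes D: "finite D" "card D = k + 2" and k: "k \<ge> 1"
    and sym: "\<And>i j. i \<in> D \<Longrightarrow> j \<in> D \<Longrightarrow> b i j = b j i"
    and below: "\<And>I. I \<subseteq> D \<Longrightarrow> card I = k - 1 \<Longrightarrow> \<not> singular_on b I"
    and at: "\<And>I. I \<subseteq> D \<Longrightarrow> card I = k \<Longrightarrow> singular_on b I"
    and above: "\<And>I. I \<subseteq> D \<Longrightarrow> card I = k + 1 \<Longrightarrow> \<not> singular_on b I"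
  obtains t s where "t \<noteq> 0" "\<And>i. i \<in> D \<Longrightarrow> s i \<noteq> 0"
    "\<And>i j. i \<in> D \<Longrightarrow> j \<in> D \<Longrightarrow> b i j = t * s i * s j * (if i = j then real k - 1 else -1)"
proof -
  have card: "card (D - {i}) = k + 1" "i \<noteq> j \<Longrightarrow> card (D - {i, j}) = k"
    "i \<noteq> j \<Longrightarrow> j \<noteq> l \<Longrightarrow> l \<noteq> i \<Longrightarrow> card (D - {i, j, l}) = k - 1"
    if "i \<in> D" "j \<in> D" "l \<in> D" for i j l
    using D that by (auto simp: card_Diff_subset)
  have one: "\<not> singular_on b (D - {i})" if "i \<in> D" for i
    using that card(1) by (intro above) auto
  have two: "singular_on b (D - {i, j})" if "i \<in> D" "j \<in> D" "i \<noteq> j" for i j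
    using that card(2) by (intro at) auto
  have three: "\<not> singular_on b (D - {i, j, l})"
    if "i \<in> D" "j \<in> D" "l \<in> D" "i \<noteq> j" "j \<noteq> l" "l \<noteq> i" for i j l
    using that card(3) by (intro below) auto
  have "\<not> singular_on b D"
    by (rule nonsingular_on_if_codim_2_singular[OF D(1) _ sym one two three]) (use D(2) k in auto)
  then obtain f where
    bf: "\<And>i l. i \<in> D \<Longrightarrow> l \<in> D \<Longrightarrow> (\<Sum>j\<in>D. b i j * f j l) = (if i = l then 1 else 0)" and
    fb: "\<And>i l. i \<in> D \<Longrightarrow> l \<in> D \<Longrightarrow> (\<Sum>j\<in>D. f i j * b j l) = (if i = l then 1 else 0)"
    using nonsingular_on_inverse[OF D(1), of b] by blast
  have f_sym: "f i j = f j i" if "i \<in> D" "j \<in> D" for i j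
    by (rule inverse_symmetric[OF D(1) sym bf that])
  have f_diag: "f i i \<noteq> 0" if "i \<in> D" for i
  proof
    assume "f i i = 0"
    then have "singular_on f {i}" by (auto simp: singular_on_def intro!: exI[of _ "\<lambda>_. 1"])
    then have "singular_on b (D - {i})"
      using that by (intro singular_on_inverse_complement[OF D(1) _ bf]) auto
    with one[OF that] show False by blast
  qed
  have f_sq: "(f i j)\<^sup>2 = f i i * f j j" if "i \<in> D" "j \<in> D" "i \<noteq> j" for i j
  proof -
    have "singular_on f (D - (D - {i, j}))"
      by (rule singular_on_inverse_complement[OF D(1) _ fb two[OF that]]) auto
    moreover have "D - (D - {i, j}) = {i, j}" using that by blast
    ultimately show ?thesis using singular_on_pair_det that f_sym by metis
  qed
  have f_tri: "f i j * f j l * f l i = - (f i i * f j j * f l l)"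
    if d: "i \<in> D" "j \<in> D" "l \<in> D" "i \<noteq> j" "j \<noteq> l" "l \<noteq> i" for i j l
  proof (rule nonsingular_on_triple_product)
    show "\<not> singular_on f {i, j, l}"
      using singular_on_inverse_complement[OF D(1) _ bf, of "{i, j, l}"] three[OF d] d by blast
  qed (use d f_sym f_diag f_sq in auto)
  obtain e r where e: "e = 1 \<or> e = -1" and r: "\<And>i. i \<in> D \<Longrightarrow> r i \<noteq> 0"
    and f: "\<And>i j. i \<in> D \<Longrightarrow> j \<in> D \<Longrightarrow> f i j = e * r i * r j * (if i = j then 1 else -1)"
    using scaled_equicorrelation[of 1 D f] f_sym f_diag f_sq f_tri by auto
  \<comment> \<open>The candidate for \<open>b\<close> comes from
    \<open>(k I - J) (2 I - J) = 2 k I\<close>, valid because \<open>J\<close> has order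
    \<open>k + 2\<close> and thus \<open>J J = (k + 2) J\<close>.\<close>
  define c where "c i j = e / (2 * k) * (1 / r i) * (1 / r j) * (if i = j then real k - 1 else -1)" for i j
  have cf: "(\<Sum>j\<in>D. c i j * f j l) = (if i = l then 1 else 0)" if il: "i \<in> D" "l \<in> D" for i l
  proof -
    have "(\<Sum>j\<in>D. c i j * f j l)
        = (\<Sum>j\<in>D. r l / (2 * k * r i) * (((if i = j then real k else 0) - 1) * ((if j = l then 2 else 0) - 1)))"
      using il e r by (intro sum.cong) (auto simp: c_def f mult_ac)
    also have "\<dots> = r l / (2 * k * r i) * (\<Sum>j\<in>D. (if j = i then (if i = l then 2 * real k else 0) else 0)
        - (if j = i then real k else 0) - (if j = l then 2 else 0) + 1)"
      unfolding sum_distrib_left by (intro sum.cong arg_cong2[of _ _ _ _ "(*)"]) auto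
    also have "(\<Sum>j\<in>D. (if j = i then (if i = l then 2 * real k else 0) else 0)
        - (if j = i then real k else 0) - (if j = l then 2 else 0) + 1) = (if i = l then 2 * real k else 0)"
      using il D by (simp add: sum.distrib sum_subtractf)
    also have "r l / (2 * k * r i) * \<dots> = (if i = l then 1 else 0)"
      using il r k by auto
    finally show ?thesis .
  qed
  have "b i m = c i m" if im: "i \<in> D" "m \<in> D" for i m
  proof -
    \<comment> \<open>Uniqueness of inverses: \<open>c = c (f b) = (c f) b = b\<close>.\<close>
    have "c i m = (\<Sum>j\<in>D. c i j * (\<Sum>l\<in>D. f j l * b l m))"
      using im D(1) by (simp add: fb if_distrib[of "\<lambda>x. c _ _ * x"] cong: if_cong)
    also have "\<dots> = (\<Sum>l\<in>D. (\<Sum>j\<in>D. c i j * f j l) * b l m)"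
      unfolding sum_distrib_left sum_distrib_right by (subst sum.swap) (simp add: mult.assoc)
    also have "\<dots> = b i m"
      using im D(1) by (simp add: cf if_distrib[of "\<lambda>x. x * b _ _"] cong: if_cong)
    finally show ?thesis by simp
  qed
  then show thesis
    using that[of "e / (2 * k)" "\<lambda>i. 1 / r i"] r e k by (auto simp: c_def)
qed

text \<open>Any three indices lie in some subset of size \<open>k + 2\<close>, where the local shape
  is known. The local factors \<open>t\<close> and \<open>s\<close> may differ between subsets, but
  they cancel from the homogeneous relations used to recognize the global shape. The bound on
  \<open>k\<close> makes the constant \<open>k - 1\<close> positive.\<close>

lemma scaled_equicorrelation_of_minors:
  fixes b :: "'i \<Rightarrow> 'i \<Rightarrow> real"
  assumes D: "finite D" "card D \<ge> k + 2" and k: "k \<ge> 2"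
    and sym: "\<And>i j. i \<in> D \<Longrightarrow> j \<in> D \<Longrightarrow> b i j = b j i"
    and below: "\<And>I. I \<subseteq> D \<Longrightarrow> card I = k - 1 \<Longrightarrow> \<not> singular_on b I"
    and at: "\<And>I. I \<subseteq> D \<Longrightarrow> card I = k \<Longrightarrow> singular_on b I"
    and above: "\<And>I. I \<subseteq> D \<Longrightarrow> card I = k + 1 \<Longrightarrow> \<not> singular_on b I"
  obtains e r where "e = 1 \<or> e = -1" "\<And>i. i \<in> D \<Longrightarrow> r i \<noteq> 0"
    "\<And>i j. i \<in> D \<Longrightarrow> j \<in> D \<Longrightarrow> b i j = e * r i * r j * (if i = j then real k - 1 else -1)"
proof -
  have local: "\<exists>t s. t \<noteq> 0 \<and> (\<forall>i\<in>T. s i \<noteq> 0) \<and>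
      (\<forall>i\<in>T. \<forall>j\<in>T. b i j = t * s i * s j * (if i = j then real k - 1 else -1))"
    if T: "T \<subseteq> D" "card T \<le> 3" for T
  proof -
    obtain E where E: "T \<subseteq> E" "E \<subseteq> D" "card E = k + 2"
      using exists_subset_between[of T "k + 2" D] T D k by auto
    have "finite E" using E D(1) finite_subset by blast
    obtain t s where "t \<noteq> 0" "\<And>i. i \<in> E \<Longrightarrow> s i \<noteq> 0"
      "\<And>i j. i \<in> E \<Longrightarrow> j \<in> E \<Longrightarrow> b i j = t * s i * s j * (if i = j then real k - 1 else -1)"
      by (rule scaled_equicorrelation_of_minors_local[OF \<open>finite E\<close> E(3), of b])
        (use E k below at above sym[OF subsetD[OF E(2)] subsetD[OF E(2)]] in auto)
    with E(1) show ?thesis by blast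
  qed
  show thesis
  proof (rule scaled_equicorrelation[of "real k - 1" D b])
    show "real k - 1 > 0" using k by simp
    show "b i j = b j i" if "i \<in> D" "j \<in> D" for i j
      using sym that by blast
    show "b i i \<noteq> 0" if "i \<in> D" for i
      using local[of "{i}"] that k by auto
    show "(real k - 1)\<^sup>2 * (b i j)\<^sup>2 = b i i * b j j" if "i \<in> D" "j \<in> D" "i \<noteq> j" for i j
      using local[of "{i, j}"] that by (auto simp: power2_eq_square)
    show "(real k - 1) ^ 3 * (b i j * b j l * b l i) = - (b i i * b j j * b l l)"
      if "i \<in> D" "j \<in> D" "l \<in> D" "i \<noteq> j" "j \<noteq> l" "l \<noteq> i" for i j l
      using local[of "{i, j, l}"] that by (auto simp: power3_eq_cube)
  qed (rule that)
qed

section \<open>Determinants of scaled equicorrelation matrices\<close>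

text \<open>With \<open>L\<close> obtained from the identity by filling its first column with ones,
  \<open>(x I - J) L = L T\<close> for an upper triangular \<open>T\<close>.\<close>

lemma det_equicorrelation:
  fixes x :: "'a::idom"
  assumes "m \<ge> 1"
  shows "det (mat m m (\<lambda>(i, j). if i = j then x - 1 else -1)) = x ^ (m - 1) * (x - of_nat m)"
    (is "det ?M = _")
proof -
  define L :: "'a mat" where "L = mat m m (\<lambda>(i, j). if j = 0 \<or> i = j then 1 else 0)"
  define T where "T = mat m m (\<lambda>(i, j). if i = 0 then (if j = 0 then x - of_nat m else -1)
      else if i = j then x else 0)"
  have car: "L \<in> carrier_mat m m" "T \<in> carrier_mat m m" "?M \<in> carrier_mat m m"
    by (auto simp: L_def T_def)
  have "?M * L = L * T"
  proof (rule eq_matI)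
    fix i j assume "i < dim_row (L * T)" "j < dim_col (L * T)"
    then have ij: "i < m" "j < m" by (auto simp: L_def T_def)
    have "(?M * L) $$ (i, j)
        = (\<Sum>r\<in>{0..<m}. (if i = r then x - 1 else -1) * (if j = 0 \<or> r = j then 1 else 0))"
      using ij by (simp add: L_def scalar_prod_def)
    also have "\<dots> = (if j = 0 then x - of_nat m else if i = j then x - 1 else -1)"
    proof (cases "j = 0")
      case True
      have "(\<Sum>r\<in>{0..<m}. if i = r then x - 1 else -1) = (\<Sum>r\<in>{0..<m}. (if i = r then x else 0) - 1)"
        by (intro sum.cong) auto
      also have "\<dots> = x - of_nat m" using ij by (simp add: sum_subtractf)
      finally show ?thesis using True by simp
    next
      case False
      then show ?thesis using ij by (simp add: if_distrib[of "\<lambda>y. _ * y"] cong: if_cong)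
    qed
    \<comment> \<open>Row \<open>i\<close> of \<open>L\<close> has ones exactly in columns 0 and
      \<open>i\<close>; the inner condition prevents counting column 0 twice when
      \<open>i = 0\<close>.\<close>
    also have "\<dots> = (\<Sum>r\<in>{0..<m}. (if r = 0 then T $$ (0, j) else 0)
        + (if r = i then (if i = 0 then 0 else T $$ (i, j)) else 0))"
      using ij by (simp add: sum.distrib) (auto simp: T_def)
    also have "\<dots> = (\<Sum>r\<in>{0..<m}. L $$ (i, r) * T $$ (r, j))"
      using ij by (intro sum.cong) (auto simp: L_def)
    also have "\<dots> = (L * T) $$ (i, j)"
      using ij car by (simp add: scalar_prod_def)
    finally show "(?M * L) $$ (i, j) = (L * T) $$ (i, j)" .
  qed (auto simp: L_def T_def)
  then have "det ?M * det L = det L * det T"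
    by (metis det_mult car)
  moreover have "det L = 1"
    using det_lower_triangular[of m L] car(1) by (simp add: prod_list_diag_prod L_def)
  moreover have "det T = x ^ (m - 1) * (x - of_nat m)"
  proof -
    have "det T = (\<Prod>i = 0..<m. T $$ (i, i))"
      using det_upper_triangular[OF _ car(2)] car(2)
      by (simp add: prod_list_diag_prod upper_triangular_def T_def)
    also have "\<dots> = T $$ (0, 0) * (\<Prod>i = Suc 0..<m. T $$ (i, i))"
      using assms by (intro prod.atLeast_Suc_lessThan) simp
    also have "\<dots> = (x - of_nat m) * (\<Prod>i = Suc 0..<m. x)"
      using assms by (intro arg_cong2[of _ _ _ _ "(*)"] prod.cong) (auto simp: T_def)
    finally show ?thesis by (simp add: mult.commute)
  qed
  ultimately show ?thesis by simp
qed

text \<open>The matrix is \<open>e\<close> times a congruence of \<open>x I - J\<close> by the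
  diagonal matrix of \<open>r\<close>, whose determinant therefore enters squared.\<close>

lemma det_scaled_equicorrelation:
  fixes r :: "nat \<Rightarrow> 'a::idom"
  assumes "m \<ge> 1"
  shows "det (mat m m (\<lambda>(i, j). e * r i * r j * (if i = j then x - 1 else -1)))
    = e ^ m * (\<Prod>i<m. r i)\<^sup>2 * x ^ (m - 1) * (x - of_nat m)"
proof -
  define M where "M = mat m m (\<lambda>(i, j). if i = j then x - 1 else -1)"
  have M: "M \<in> carrier_mat m m" by (simp add: M_def)
  have dm: "det (mat_diag m r) = (\<Prod>i<m. r i)"
    using det_lower_triangular[of m "mat_diag m r"]
    by (simp add: prod_list_diag_prod mat_diag_def atLeast0LessThan)
  have "mat m m (\<lambda>(i, j). e * r i * r j * (if i = j then x - 1 else -1))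
      = e \<cdot>\<^sub>m (mat_diag m r * (M * mat_diag m r))"
    by (simp add: mat_diag_mult_right[OF M] mat_diag_mult_left[of _ m m])
      (auto intro!: eq_matI simp: M_def mult_ac)
  also have "det \<dots> = e ^ m * ((\<Prod>i<m. r i) * (det M * (\<Prod>i<m. r i)))"
    using det_mult[of "mat_diag m r" m "M * mat_diag m r"] det_mult[OF M, of "mat_diag m r"] M dm
    by (simp add: mat_diag_def)
  finally show ?thesis
    using det_equicorrelation[OF assms, of x] by (simp add: M_def power2_eq_square mult_ac)
qed

section \<open>Principal submatrices and the meaning of the symbols\<close>

lemma bij_betw_pick:
  assumes "finite I"
  shows "bij_betw (pick I) {0..<card I} I"
proof (rule bij_betw_imageI)
  show inj: "inj_on (pick I) {0..<card I}"
  proof (rule linorder_inj_onI')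
    fix i j assume "j \<in> {0..<card I}" "i < j"
    then show "pick I i \<noteq> pick I j" using pick_mono_le[of j I i] by auto
  qed
  show "pick I ` {0..<card I} = I"
    using assms pick_in_set_le[of _ I] inj
    by (intro card_subset_eq) (auto simp: card_image)
qed

lemma submatrix_principal:
  assumes "B \<in> carrier_mat n n" "I \<subseteq> {0..<n}"
  shows "submatrix B I I = mat (card I) (card I) (\<lambda>(i, j). B $$ (pick I i, pick I j))"
proof -
  have "{i. i < n \<and> i \<in> I} = I" using assms(2) by auto
  then show ?thesis using assms(1) by (simp add: submatrix_def)
qed

lemma det_submatrix_eq_0_iff_singular_on:
  fixes B :: "'a::field mat"
  assumes "B \<in> carrier_mat n n" "I \<subseteq> {0..<n}"
  shows "det (submatrix B I I) = 0 \<longleftrightarrow> singular_on (\<lambda>i j. B $$ (i, j)) I"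
proof -
  have "finite I" using assms(2) finite_subset by blast
  from det_eq_0_iff_singular_on[OF bij_betw_pick[OF this], of "\<lambda>i j. B $$ (i, j)"]
  show ?thesis by (simp add: submatrix_principal[OF assms])
qed

text \<open>Nothing is known about the symbol \<open>undefined\<close>, so the last branch must be
  excluded. All branch conditions are rewritten in terms of the existence of positive and of
  negative minors; once a zero minor exists, only \<open>N\<close> and \<open>S\<close> symbols are
  left.\<close>

lemma principal_minors_nonzero_if_eprA:
  fixes B :: "real mat"
  assumes A: "underlying (sepr_term B m) = eprA" and x: "x \<in> principal_minors B m"
  shows "x \<noteq> 0"
proof
  assume "x = 0"
  define M where "M = principal_minors B m"
  have zero: "(\<exists>x\<in>M. x = 0) = True" "(\<forall>x\<in>M. x \<noteq> 0) = False"
    "(\<forall>x\<in>M. x > 0) = False" "(\<forall>x\<in>M. x < 0) = False"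
    using x \<open>x = 0\<close> by (auto simp: M_def)
  have sign: "(\<forall>x\<in>M. x = 0) \<longleftrightarrow> \<not> (\<exists>x\<in>M. x > 0) \<and> \<not> (\<exists>x\<in>M. x < 0)"
    "(\<exists>x\<in>M. x \<noteq> 0) \<longleftrightarrow> (\<exists>x\<in>M. x > 0) \<or> (\<exists>x\<in>M. x < 0)"
    "(\<forall>x\<in>M. x \<noteq> 0 \<longrightarrow> x > 0) \<longleftrightarrow> \<not> (\<exists>x\<in>M. x < 0)"
    "(\<forall>x\<in>M. x \<noteq> 0 \<longrightarrow> x < 0) \<longleftrightarrow> \<not> (\<exists>x\<in>M. x > 0)"
    by (force simp: linorder_neq_iff not_less)+
  from A show False
    unfolding sepr_term_def Let_def M_def[symmetric] zero sign by (auto split: if_splits)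
qed

lemma principal_minors_zero_if_eprN:
  fixes B :: "real mat"
  assumes N: "underlying (sepr_term B m) = eprN" and x: "x \<in> principal_minors B m"
  shows "x = 0"
proof (rule ccontr)
  assume "x \<noteq> 0"
  define M where "M = principal_minors B m"
  have nz: "(\<exists>x\<in>M. x > 0) \<or> (\<exists>x\<in>M. x < 0)" "(\<forall>x\<in>M. x = 0) = False" "(\<exists>x\<in>M. x \<noteq> 0) = True"
    using x \<open>x \<noteq> 0\<close> by (auto simp: M_def linorder_neq_iff)
  have pos: "0 < x \<longleftrightarrow> \<not> x < 0 \<and> x \<noteq> 0" for x :: real by linarith
  have neg: "x < 0 \<longleftrightarrow> \<not> 0 < x \<and> x \<noteq> 0" for x :: real by linarith
  have sign:
    "(\<forall>x\<in>M. x \<noteq> 0 \<longrightarrow> x > 0) \<longleftrightarrow> \<not> (\<exists>x\<in>M. x < 0)"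
    "(\<forall>x\<in>M. x \<noteq> 0 \<longrightarrow> x < 0) \<longleftrightarrow> \<not> (\<exists>x\<in>M. x > 0)"
    "(\<forall>x\<in>M. x > 0) \<longleftrightarrow> \<not> (\<exists>x\<in>M. x < 0) \<and> \<not> (\<exists>x\<in>M. x = 0)"
    "(\<forall>x\<in>M. x < 0) \<longleftrightarrow> \<not> (\<exists>x\<in>M. x > 0) \<and> \<not> (\<exists>x\<in>M. x = 0)"
    "(\<forall>x\<in>M. x \<noteq> 0) \<longleftrightarrow> \<not> (\<exists>x\<in>M. x = 0)"
    subgoal by (force simp: linorder_neq_iff not_less)
    subgoal by (force simp: linorder_neq_iff not_less)
    subgoal unfolding pos by blast
    subgoal unfolding neg by blast
    subgoal by blast
    done
  \<comment> \<open>Treating the three existence statements as Boolean variables turns the branch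
    analysis into propositional reasoning.\<close>
  obtain P Q Z where PQZ: "(\<exists>x\<in>M. 0 < x) = P" "(\<exists>x\<in>M. x < 0) = Q" "(\<exists>x\<in>M. x = 0) = Z"
    by blast
  from N nz(1) show False
    unfolding sepr_term_def Let_def M_def[symmetric] nz(2,3) sign PQZ by (auto split: if_splits)
qed

section \<open>The two model sequences\<close>

definition equicorrelation_term :: "real \<Rightarrow> nat \<Rightarrow> nat \<Rightarrow> sepr_symbol" where
  "equicorrelation_term e k m =
    (if m = k then NN else if e ^ m * (real k - real m) > 0 then Aplus else Aminus)"

text \<open>Every principal minor of order \<open>m\<close> is a positive multiple of the same
  number \<open>d\<close>, so one sign decides the whole term.\<close>

lemma sepr_scaled_equicorrelation:
  fixes B :: "real mat"
  assumes B: "B \<in> carrier_mat n n" and k: "k \<ge> 1"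
    and e: "e = 1 \<or> e = -1" and r: "\<And>i. i < n \<Longrightarrow> r i \<noteq> 0"
    and entries: "\<And>i j. i < n \<Longrightarrow> j < n \<Longrightarrow>
      B $$ (i, j) = e * r i * r j * (if i = j then real k - 1 else -1)"
  shows "sepr B = map (equicorrelation_term e k) [1..<n + 1]"
proof -
  have "sepr_term B m = equicorrelation_term e k m" if m: "1 \<le> m" "m \<le> n" for m
  proof -
    define d where "d = e ^ m * (real k - real m)"
    have minor: "\<exists>p>0. det (submatrix B I I) = p * d" if I: "I \<subseteq> {0..<n}" "card I = m" for I
    proof -
      have "finite I" using I finite_subset by blast
      from bij_betw_pick[OF this] have pick: "inj_on (pick I) {0..<m}" "pick I ` {0..<m} = I"
        using I by (auto simp: bij_betw_def)
      then have pn: "pick I i < n" if "i < m" for i using that I by force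
      have pe: "pick I i = pick I j \<longleftrightarrow> i = j" if "i < m" "j < m" for i j
        using pick(1) that by (auto simp: inj_on_def)
      have "submatrix B I I = mat m m (\<lambda>(i, j). e * r (pick I i) * r (pick I j)
          * (if i = j then real k - 1 else -1))"
        unfolding submatrix_principal[OF B I(1)] I(2)
        by (intro eq_matI) (auto simp: entries pn pe)
      then have "det (submatrix B I I) = ((\<Prod>i<m. r (pick I i))\<^sup>2 * real k ^ (m - 1)) * d"
        using det_scaled_equicorrelation[OF m(1), of e "\<lambda>i. r (pick I i)" "real k"]
        by (simp add: d_def)
      moreover have "(\<Prod>i<m. r (pick I i))\<^sup>2 * real k ^ (m - 1) > 0"
        using k r pn by simp
      ultimately show ?thesis by blast
    qed
    \<comment> \<open>Minors of order \<open>m\<close> exist since \<open>m \<le> n\<close>; for an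
      empty set of minors the branch \<open>Aplus\<close> would hold vacuously.\<close>
    obtain I where "I \<subseteq> {0..<n}" "card I = m"
      using obtain_subset_with_card_n[of m "{0..<n}"] m by auto
    then have ne: "\<exists>x. x \<in> principal_minors B m"
      using B by (auto simp: principal_minors_def)
    have sgn: "(x > 0 \<longleftrightarrow> d > 0) \<and> (x < 0 \<longleftrightarrow> d < 0) \<and> (x = 0 \<longleftrightarrow> d = 0)"
      if x: "x \<in> principal_minors B m" for x
    proof -
      obtain I where "I \<subseteq> {0..<n}" "card I = m" "x = det (submatrix B I I)"
        using x B by (auto simp: principal_minors_def)
      with minor obtain p where "p > 0" "x = p * d" by blast
      then show ?thesis by (auto simp: zero_less_mult_iff mult_less_0_iff)
    qed
    consider "d > 0" | "d < 0" | "d = 0" by linarith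
    then show ?thesis
    proof cases
      case 1
      then have "\<forall>x\<in>principal_minors B m. x > 0" using sgn by blast
      with 1 ne show ?thesis
        by (auto simp: sepr_term_def Let_def equicorrelation_term_def d_def)
    next
      case 2
      then have "\<forall>x\<in>principal_minors B m. x < 0" using sgn by blast
      with 2 ne show ?thesis
        by (force simp: sepr_term_def Let_def equicorrelation_term_def d_def)
    next
      case 3
      then have "\<forall>x\<in>principal_minors B m. x = 0" using sgn by blast
      moreover have "m = k" using 3 e by (auto simp: d_def)
      ultimately show ?thesis using ne
        by (force simp: sepr_term_def Let_def equicorrelation_term_def)
    qed
  qed
  then show ?thesis using B by (auto simp: sepr_def)
qed

text \<open>Away from \<open>k - 1\<close> and \<open>k\<close> the sign of \<open>k - m\<close>
  does not change from \<open>m\<close> to \<open>m + 1\<close>, so only the additional factor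
  \<open>e\<close> matters.\<close>

lemma equicorrelation_term_Suc:
  assumes e: "e = 1 \<or> e = -1" and "m \<noteq> k" "Suc m \<noteq> k"
  shows "equicorrelation_term e k (Suc m) =
    (if e = 1 then equicorrelation_term e k m else neg (equicorrelation_term e k m))"
proof -
  have p: "e ^ m = 1 \<or> e ^ m = -1" using e by (cases "even m") auto
  have "m < k \<and> Suc m < k \<or> m > k" using assms by linarith
  then show ?thesis using e p by (auto simp: equicorrelation_term_def)
qed

lemma neg_neg [simp]: "neg (neg t) = t"
  by (cases t) auto

text \<open>The recurrence \<open>t\<^bsub>i+1\<^esub> = neg t\<^sub>i\<close> is broken at \<open>k - 1\<close> and \<open>k\<close>, hence a solution is determined by
  its terms \<open>k - 1\<close>, \<open>k\<close> and \<open>k + 1\<close>.\<close>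

lemma neg_recurrence_unique:
  fixes s t :: "nat \<Rightarrow> sepr_symbol"
  assumes s: "\<And>i. i \<in> {1..n - 1} - {k - 1, k} \<Longrightarrow> s (i + 1) = neg (s i)"
    and t: "\<And>i. i \<in> {1..n - 1} - {k - 1, k} \<Longrightarrow> t (i + 1) = neg (t i)"
    and eq: "s (k - 1) = t (k - 1)" "s k = t k" "s (k + 1) = t (k + 1)"
    and k: "2 \<le> k" "k < n" and i: "1 \<le> i" "i \<le> n"
  shows "s i = t i"
proof -
  consider "i \<le> k - 1" | "i = k" | "k + 1 \<le> i" by linarith
  then show ?thesis
  proof cases
    case 1
    then show ?thesis using i(1)
    proof (induction rule: inc_induct)
      case base
      then show ?case using eq by simp
    next
      case (step m)
      then have "m \<in> {1..n - 1} - {k - 1, k}" using k by auto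
      then have "neg (s m) = neg (t m)" using s[of m] t[of m] step by simp
      then show ?case by (metis neg_neg)
    qed
  next
    case 2
    then show ?thesis using eq by simp
  next
    case 3
    then show ?thesis using i(2)
    proof (induction rule: dec_induct)
      case base
      then show ?case using eq by simp
    next
      case (step m)
      then have "m \<in> {1..n - 1} - {k - 1, k}" using k by auto
      then show ?case using s[of m] t[of m] step by simp
    qed
  qed
qed

text \<open>The only \<open>N\<close> of such a list is term \<open>a + 2\<close>, which forces
  \<open>a = k - 2\<close>; the length then forces \<open>b = n - k - 2\<close>.\<close>

lemma replicate_form_iff:
  assumes len: "length \<sigma> = n" and k: "2 \<le> k" "k \<le> n - 2"
    and N: "underlying (entry \<sigma> k) = eprN"
  shows "(\<exists>a b. \<sigma> = replicate a Aplus @ [Aplus, NN, Aminus, Aminus] @ replicate b Aminus)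
    \<longleftrightarrow> \<sigma> = map (equicorrelation_term 1 k) [1..<n + 1]"
proof -
  have form: "replicate a Aplus @ [Aplus, NN, Aminus, Aminus] @ replicate b Aminus
      = map (equicorrelation_term 1 (a + 2)) [1..<a + 4 + b + 1]" for a b
  proof (rule nth_equalityI)
    fix i assume "i < length (replicate a Aplus @ [Aplus, NN, Aminus, Aminus] @ replicate b Aminus)"
    then have i: "i < a + 4 + b" by simp
    consider "i < a" | "i = a" | "i = a + 1" | "i = a + 2" | "i = a + 3" | "i \<ge> a + 4" by linarith
    then show "(replicate a Aplus @ [Aplus, NN, Aminus, Aminus] @ replicate b Aminus) ! i
      = map (equicorrelation_term 1 (a + 2)) [1..<a + 4 + b + 1] ! i"
      using i by cases (auto simp: nth_append nth_Cons' equicorrelation_term_def simp del: upt_Suc)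
  qed simp
  show ?thesis
  proof
    assume "\<exists>a b. \<sigma> = replicate a Aplus @ [Aplus, NN, Aminus, Aminus] @ replicate b Aminus"
    then obtain a b where "\<sigma> = replicate a Aplus @ [Aplus, NN, Aminus, Aminus] @ replicate b Aminus"
      by blast
    then have \<sigma>: "\<sigma> = map (equicorrelation_term 1 (a + 2)) [1..<a + 4 + b + 1]"
      using form by simp
    then have n: "n = a + 4 + b" using len by simp
    then have "entry \<sigma> k = equicorrelation_term 1 (a + 2) k"
      using \<sigma> k by (simp add: entry_def del: upt_Suc)
    then have "k = a + 2" using N by (auto simp: equicorrelation_term_def split: if_splits)
    with \<sigma> n show "\<sigma> = map (equicorrelation_term 1 k) [1..<n + 1]" by simp
  next
    assume "\<sigma> = map (equicorrelation_term 1 k) [1..<n + 1]"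
    moreover have "k = (k - 2) + 2" "n = (k - 2) + 4 + (n - k - 2)" using k by auto
    ultimately have "\<sigma> = replicate (k - 2) Aplus @ [Aplus, NN, Aminus, Aminus] @ replicate (n - k - 2) Aminus"
      using form[of "k - 2" "n - k - 2"] by metis
    then show "\<exists>a b. \<sigma> = replicate a Aplus @ [Aplus, NN, Aminus, Aminus] @ replicate b Aminus"
      by blast
  qed
qed

text \<open>The odd and even alternatives are treated together, with \<open>x\<close> the sign of
  \<open>(-1) ^ (k - 1)\<close>. The four central terms and the recurrence leave a single sequence,
  the one for \<open>e = -1\<close>.\<close>

lemma neg_recurrence_iff:
  assumes len: "length \<sigma> = n" and k: "2 \<le> k" "k \<le> n - 2"
    and x: "x = (if odd k then Aplus else Aminus)"
  shows "[entry \<sigma> (k - 1), entry \<sigma> k, entry \<sigma> (k + 1), entry \<sigma> (k + 2)] = [x, NN, neg x, x]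
      \<and> (\<forall>i \<in> {1..n - 1} - {k - 1, k}. entry \<sigma> (i + 1) = neg (entry \<sigma> i))
    \<longleftrightarrow> \<sigma> = map (equicorrelation_term (-1) k) [1..<n + 1]"
    (is "?four \<and> ?rec \<longleftrightarrow> _ = ?model")
proof -
  let ?t = "equicorrelation_term (-1) k"
  obtain j where j: "k = j + 2" using k(1) by (metis le_add_diff_inverse2)
  have four: "[?t (k - 1), ?t k, ?t (k + 1), ?t (k + 2)] = [x, NN, neg x, x]"
    by (auto simp: x j equicorrelation_term_def)
  have rec: "?t (i + 1) = neg (?t i)" if "i \<in> {1..n - 1} - {k - 1, k}" for i
    using that k equicorrelation_term_Suc[of "-1" i k] by auto
  have model: "entry ?model i = ?t i" if "1 \<le> i" "i \<le> n" for i
    using that by (simp add: entry_def del: upt_Suc)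
  show ?thesis
  proof
    assume a: "?four \<and> ?rec"
    have eq: "entry \<sigma> i = ?t i" if "1 \<le> i" "i \<le> n" for i
      by (rule neg_recurrence_unique[where k = k and n = n]) (use a four rec that k in auto)
    have "\<sigma> ! i = ?model ! i" if "i < n" for i
      using eq[of "Suc i"] model[of "Suc i"] that by (simp add: entry_def del: upt_Suc)
    then show "\<sigma> = ?model" using len by (intro nth_equalityI) auto
  next
    assume \<sigma>: "\<sigma> = ?model"
    have m: "entry \<sigma> i = ?t i" if "1 \<le> i" "i \<le> n" for i
      unfolding \<sigma> using that by (rule model)
    have "entry \<sigma> (i + 1) = neg (entry \<sigma> i)" if i: "i \<in> {1..n - 1} - {k - 1, k}" for i
    proof -
      have "1 \<le> i" "i + 1 \<le> n" using i k by auto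
      then show ?thesis using m[of i] m[of "i + 1"] rec[OF i] by simp
    qed
    moreover have "?four"
      using four m[of "k - 1"] m[of k] m[of "k + 1"] m[of "k + 2"] k by simp
    ultimately show "?four \<and> ?rec" by blast
  qed
qed

theorem theorem5p6:
  fixes \<sigma> :: "sepr_symbol list" and n k :: nat
  assumes "length \<sigma> = n"
    and "2 \<le> k" and "k \<le> n - 2"
    and "underlying (entry \<sigma> (k - 1)) = eprA"
    and "underlying (entry \<sigma> k) = eprN"
    and "underlying (entry \<sigma> (k + 1)) = eprA"
  shows "(\<exists>B :: real mat. B \<in> carrier_mat n n \<and> transpose_mat B = B \<and> sepr B = \<sigma>) \<longleftrightarrow>
    ((\<exists>a b. \<sigma> = replicate a Aplus @ [Aplus, NN, Aminus, Aminus] @ replicate b Aminus)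
     \<or> (odd k
        \<and> [entry \<sigma> (k - 1), entry \<sigma> k, entry \<sigma> (k + 1), entry \<sigma> (k + 2)]
            = [Aplus, NN, Aminus, Aplus]
        \<and> (\<forall>i \<in> {1..n - 1} - {k - 1, k}. entry \<sigma> (i + 1) = neg (entry \<sigma> i)))
     \<or> (even k
        \<and> [entry \<sigma> (k - 1), entry \<sigma> k, entry \<sigma> (k + 1), entry \<sigma> (k + 2)]
            = [Aminus, NN, Aplus, Aminus]
        \<and> (\<forall>i \<in> {1..n - 1} - {k - 1, k}. entry \<sigma> (i + 1) = neg (entry \<sigma> i))))"
    (is "?L \<longleftrightarrow> ?R")
proof -
  let ?model = "\<lambda>e. map (equicorrelation_term e k) [1..<n + 1]"
  have R: "?R \<longleftrightarrow> \<sigma> = ?model 1 \<or> \<sigma> = ?model (-1)"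
    unfolding replicate_form_iff[OF assms(1-3,5)] neg_recurrence_iff[OF assms(1-3) refl, symmetric]
    by (cases "even k") auto
  have L: "?L \<longleftrightarrow> \<sigma> = ?model 1 \<or> \<sigma> = ?model (-1)"
  proof
    assume ?L
    then obtain B :: "real mat" where B: "B \<in> carrier_mat n n" "transpose_mat B = B" "sepr B = \<sigma>"
      by blast
    let ?b = "\<lambda>i j. B $$ (i, j)"
    have sym: "?b i j = ?b j i" if "i \<in> {0..<n}" "j \<in> {0..<n}" for i j
      using that B(1) arg_cong[OF B(2), of "\<lambda>A. A $$ (i, j)"] by simp
    have entry: "entry \<sigma> m = sepr_term B m" if "1 \<le> m" "m \<le> n" for m
      unfolding B(3)[symmetric] using that B(1) by (simp add: entry_def sepr_def del: upt_Suc)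
    have mem: "det (submatrix B I I) \<in> principal_minors B m" if "I \<subseteq> {0..<n}" "card I = m" for I m
      using that B(1) by (auto simp: principal_minors_def)
    have A: "\<not> singular_on ?b I"
      if "I \<subseteq> {0..<n}" "card I = m" "underlying (sepr_term B m) = eprA" for I m
      using principal_minors_nonzero_if_eprA[OF that(3) mem[OF that(1,2)]]
        det_submatrix_eq_0_iff_singular_on[OF B(1) that(1)] by blast
    have N: "singular_on ?b I"
      if "I \<subseteq> {0..<n}" "card I = m" "underlying (sepr_term B m) = eprN" for I m
      using principal_minors_zero_if_eprN[OF that(3) mem[OF that(1,2)]]
        det_submatrix_eq_0_iff_singular_on[OF B(1) that(1)] by blast
    \<comment> \<open>Since \<open>k + 2 \<le> n\<close>, the \<open>ANA\<close> pattern on all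
      index sets determines the matrix up to diagonal scaling and the sign \<open>e\<close>.\<close>
    obtain e r where e: "e = 1 \<or> e = -1" and r: "\<And>i. i \<in> {0..<n} \<Longrightarrow> r i \<noteq> 0"
      and b: "\<And>i j. i \<in> {0..<n} \<Longrightarrow> j \<in> {0..<n} \<Longrightarrow>
        ?b i j = e * r i * r j * (if i = j then real k - 1 else -1)"
    proof (rule scaled_equicorrelation_of_minors[of "{0..<n}" k ?b])
      show "\<not> singular_on ?b I" if "I \<subseteq> {0..<n}" "card I = k - 1" for I
        by (rule A[OF that]) (use assms entry[of "k - 1"] in auto)
      show "singular_on ?b I" if "I \<subseteq> {0..<n}" "card I = k" for I
        by (rule N[OF that]) (use assms entry[of k] in auto)
      show "\<not> singular_on ?b I" if "I \<subseteq> {0..<n}" "card I = k + 1" for I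
        by (rule A[OF that]) (use assms entry[of "k + 1"] in auto)
    qed (use assms sym in auto)
    have "sepr B = ?model e"
      by (rule sepr_scaled_equicorrelation[OF B(1) _ e, of k r]) (use assms r b in auto)
    with e B(3) show "\<sigma> = ?model 1 \<or> \<sigma> = ?model (-1)" by auto
  next
    have ex: "\<exists>B :: real mat. B \<in> carrier_mat n n \<and> transpose_mat B = B \<and> sepr B = ?model e"
      if e: "e = 1 \<or> e = -1" for e
    proof (intro exI conjI)
      \<comment> \<open>The unscaled matrices \<open>k I - J\<close> and \<open>J - k I\<close>
        realize the two sequences.\<close>
      let ?B = "mat n n (\<lambda>(i, j). e * (if i = j then real k - 1 else -1))"
      show "?B \<in> carrier_mat n n" by simp
      show "transpose_mat ?B = ?B" by (intro eq_matI) auto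
      show "sepr ?B = ?model e"
        by (rule sepr_scaled_equicorrelation[OF _ _ e, of _ _ _ "\<lambda>_. 1"]) (use assms in auto)
    qed
    assume "\<sigma> = ?model 1 \<or> \<sigma> = ?model (-1)"
    then show ?L using ex by auto
  qed
  show ?thesis using L R by blast
qed

end
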